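(* Let $a,b>0$ and $0\le t\le 1$. Then for every $0<p\le 1$: (1) $$a^{1-t}b^{t}\le \left\{(1-t)a^p+tb^p\right\}^{1/p}\le (1-t)a+tb.$$ (2) $$\sqrt{ab}\le \left(H_t(a^p,b^p)\right)^{1/p}\le H_t(a,b).$$
   Context: For $x,y>0$ and $0\le t\le 1$, $H_t(x,y):=\dfrac{x^{1-t}y^{t}+x^{t}y^{1-t}}{2}$ is the Heinz mean. *)

theory Defs
  imports Complex_Main
begin

definition heinz_mean :: "real \<Rightarrow> real \<Rightarrow> real \<Rightarrow> real" where
  "heinz_mean t x y = (x powr (1 - t) * y powr t + x powr t * y powr (1 - t)) / 2"

end

theory Submission
  imports Defs "HOL-Analysis.Convex"
begin

text \<open>
  Part (1) places the weighted power mean of exponent p between the geometric mean (Young's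
  inequality for \<open>a\<^sup>p\<close> and \<open>b\<^sup>p\<close>) and the arithmetic mean (convexity of \<open>x \<mapsto> x\<^bsup>1/p\<^esup>\<close>).
  Part (2) is part (1) with weight 1/2 for the numbers \<open>a\<^bsup>1-t\<^esup> b\<^sup>t\<close> and \<open>a\<^sup>t b\<^bsup>1-t\<^esup>\<close>, whose
  product is \<open>a b\<close>.
\<close>

lemma geometric_mean_le_power_mean:
  fixes a b t p :: real
  assumes "a > 0" "b > 0" "0 \<le> t" "t \<le> 1" "0 < p"
  shows "a powr (1 - t) * b powr t \<le> ((1 - t) * a powr p + t * b powr p) powr (1 / p)"
proof -
  \<comment> \<open>Pulling out the exponent \<open>1 / p\<close> reduces the claim to Young's
    inequality under the increasing map \<open>u powr (1 / p)\<close>.\<close>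
  have "a powr (1 - t) * b powr t = ((a powr p) powr (1 - t) * (b powr p) powr t) powr (1 / p)"
    using assms by (simp add: powr_mult powr_powr)
  also have "\<dots> \<le> ((1 - t) * a powr p + t * b powr p) powr (1 / p)"
    using assms Youngs_inequality_0[of "1 - t" t "a powr p" "b powr p"]
    by (intro powr_mono2) auto
  finally show ?thesis .
qed

lemma power_mean_le_arithmetic_mean:
  fixes a b t p :: real
  assumes "a > 0" "b > 0" "0 \<le> t" "t \<le> 1" "0 < p" "p \<le> 1"
  shows "((1 - t) * a powr p + t * b powr p) powr (1 / p) \<le> (1 - t) * a + t * b"
  \<comment> \<open>Here \<open>p \<le> 1\<close> enters: convexity needs
    \<open>1 / p \<ge> 1\<close>. At the chosen points the exponents \<open>p\<close> and
    \<open>1 / p\<close> cancel.\<close>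
  using convex_onD[OF powr_convex[of "1 / p"], of t "a powr p" "b powr p"] assms
  by (simp add: powr_powr)

text \<open>Powers distribute over products and exponents commute. The coefficient
  \<open>1 - 1 / 2\<close> is left unevaluated to match the two power mean lemmas at weight
  \<open>1 / 2\<close>.\<close>

lemma heinz_mean_powr:
  "heinz_mean t (a powr p) (b powr p) =
    (1 - 1 / 2) * (a powr (1 - t) * b powr t) powr p + 1 / 2 * (a powr t * b powr (1 - t)) powr p"
  by (simp add: heinz_mean_def powr_mult powr_powr mult.commute add_divide_distrib)

theorem proposition2p2:
  fixes a b t p :: real
  assumes "a > 0" and "b > 0" and "0 \<le> t" and "t \<le> 1" and "0 < p" and "p \<le> 1"
  shows "(a powr (1 - t) * b powr t \<le> ((1 - t) * a powr p + t * b powr p) powr (1 / p)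
          \<and> ((1 - t) * a powr p + t * b powr p) powr (1 / p) \<le> (1 - t) * a + t * b)
       \<and> (sqrt (a * b) \<le> heinz_mean t (a powr p) (b powr p) powr (1 / p)
          \<and> heinz_mean t (a powr p) (b powr p) powr (1 / p) \<le> heinz_mean t a b)"
proof -
  define x where "x = a powr (1 - t) * b powr t"
  define y where "y = a powr t * b powr (1 - t)"
  have pos: "x > 0" "y > 0"
    using assms by (simp_all add: x_def y_def)
  have "x * y = (a powr (1 - t) * a powr t) * (b powr t * b powr (1 - t))"
    by (simp add: x_def y_def mult_ac)
  also have "\<dots> = a * b"
    using assms by (simp flip: powr_add)
  \<comment> \<open>The square root of \<open>x * y\<close> splits into the weighted geometric mean
    of \<open>x\<close> and \<open>y\<close> at weight \<open>1 / 2\<close>.\<close>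
  finally have "sqrt (a * b) = x powr (1 - 1 / 2) * y powr (1 / 2)"
    using pos by (simp add: powr_half_sqrt flip: real_sqrt_mult)
  moreover have "heinz_mean t (a powr p) (b powr p) = (1 - 1 / 2) * x powr p + 1 / 2 * y powr p"
    unfolding x_def y_def by (rule heinz_mean_powr)
  moreover have "heinz_mean t a b = (1 - 1 / 2) * x + 1 / 2 * y"
    by (simp add: heinz_mean_def x_def y_def add_divide_distrib)
  ultimately have "sqrt (a * b) \<le> heinz_mean t (a powr p) (b powr p) powr (1 / p)"
    and "heinz_mean t (a powr p) (b powr p) powr (1 / p) \<le> heinz_mean t a b"
    using geometric_mean_le_power_mean[of x y "1 / 2" p]
      power_mean_le_arithmetic_mean[of x y "1 / 2" p] pos assms by simp_all
  then show ?thesis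
    using geometric_mean_le_power_mean[of a b t p] power_mean_le_arithmetic_mean[of a b t p] assms
    by blast
qed

end
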